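(* Let $k\ge 3$ and $n\ge 3k$ be integers, and let $G$ be a connected graph on $n$ vertices with at most $\left(1+\frac{1}{27k^2}\right)n$ edges. Then $r(G,P_k)\le n+k-2$.
   Context: All graphs are finite and simple. For graphs $H_1,H_2$, the Ramsey number $r(H_1,H_2)$ is the smallest positive integer $N$ such that every graph $\Gamma$ on $N$ vertices contains $H_1$ as a (not necessarily induced) subgraph or its complement $\overline{\Gamma}$ contains $H_2$ as a subgraph. $P_k$ is the path on $k$ vertices. *)

theory Defs
  imports Complex_Main "HOL-Library.Ramsey"
begin

record 'a ugraph =
  verts :: "'a set"
  edges :: "'a set set"

text \<open>\<^term>\<open>nsets V 2\<close> is the set of two-element subsets of \<^term>\<open>V\<close>, so there are
  no loops and no multiple edges.\<close>

definition simple_graph :: "'a ugraph \<Rightarrow> bool" where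
  "simple_graph G \<longleftrightarrow> finite (verts G) \<and> edges G \<subseteq> nsets (verts G) 2"

definition adj :: "'a ugraph \<Rightarrow> ('a \<times> 'a) set" where
  "adj G = {(u, v). {u, v} \<in> edges G}"

definition connected_graph :: "'a ugraph \<Rightarrow> bool" where
  "connected_graph G \<longleftrightarrow>
     verts G \<noteq> {} \<and> (\<forall>u\<in>verts G. \<forall>v\<in>verts G. (u, v) \<in> (adj G)\<^sup>*)"

definition complement_graph :: "'a ugraph \<Rightarrow> 'a ugraph" where
  "complement_graph G = \<lparr>verts = verts G, edges = nsets (verts G) 2 - edges G\<rparr>"

text \<open>\<^term>\<open>G\<close> contains a copy of \<^term>\<open>H\<close> as a subgraph, not necessarily induced.\<close>

definition contains_graph :: "'a ugraph \<Rightarrow> 'b ugraph \<Rightarrow> bool" where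
  "contains_graph G H \<longleftrightarrow>
     (\<exists>f. inj_on f (verts H) \<and> f ` verts H \<subseteq> verts G \<and> (\<forall>e\<in>edges H. f ` e \<in> edges G))"

definition path_graph :: "nat \<Rightarrow> nat ugraph" where
  "path_graph k = \<lparr>verts = {..<k}, edges = {{i, Suc i} | i. Suc i < k}\<rparr>"

text \<open>Every finite graph is isomorphic to one whose vertices are natural numbers, so it is no
  restriction that the host graphs \<^term>\<open>\<Gamma>\<close> have vertices of type \<^typ>\<open>nat\<close>.
  For finite simple graphs the minimum exists by Ramsey's theorem.\<close>

definition ramsey_number :: "'a ugraph \<Rightarrow> 'b ugraph \<Rightarrow> nat" where
  "ramsey_number H1 H2 =
     (LEAST N. N > 0 \<and>
        (\<forall>\<Gamma> :: nat ugraph. simple_graph \<Gamma> \<and> card (verts \<Gamma>) = N \<longrightarrow>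
           contains_graph \<Gamma> H1 \<or> contains_graph (complement_graph \<Gamma>) H2))"

end

theory Submission
  imports Defs
begin

text \<open>
  Let \<open>H\<close> be a graph without \<open>P\<^sub>k\<close>. Depth-first search in \<open>H\<close> yields, for every prescribed size
  \<open>a\<close>, a set \<open>A\<close> of \<open>a\<close> finished vertices whose outer neighbours lie on a path of at most \<open>k - 2\<close>
  vertices, so that the complement of \<open>H\<close> contains all complete bipartite graphs of order \<open>n\<close>. It
  also yields a large independent set of vertices of degree at most \<open>k - 2\<close>, the leaves of the
  search forest.

  A spanning tree of \<open>G\<close> gives a bipartition \<open>X, Y\<close> with few edges inside the sides. If both sides
  are large, \<open>X\<close> and \<open>Y\<close> are mapped to the two sides of such a bipartite graph, the endpoints of
  the bad edges going to independent sets of \<open>H\<close>. If \<open>X\<close> is small, almost all vertices of \<open>G\<close> are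
  leaves attached to \<open>X\<close>; then the other vertices are embedded first, with \<open>X\<close> on vertices of
  degree at most \<open>k - 2\<close> in \<open>H\<close>, and the leaves are added greedily. The independent set of
  search leaves provides the room for this, unless \<open>G\<close> is unicyclic and \<open>n\<close> may be of order \<open>k\<close>.
  In that case a finished set \<open>A\<close> of the size of \<open>X\<close> either is not a clique of \<open>H\<close>, or consists of
  low-degree vertices at the end of a path, and one end of the bad edge is mapped off this path.
\<close>

section \<open>Depth-first search in graphs without long paths\<close>

text \<open>\<open>h\<close> is the adjacency of \<open>H\<close>; keeping \<open>V\<close> separate
  lets all results pass to induced subgraphs.\<close>

locale path_free =
  fixes V :: "'b set" and h :: "'b \<Rightarrow> 'b \<Rightarrow> bool" and k :: nat
  assumes finite_V: "finite V"
    and sym: "h u v \<Longrightarrow> h v u"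
    and irrefl: "\<not> h v v"
    and path_short: "\<lbrakk>distinct p; successively h p; set p \<subseteq> V\<rbrakk> \<Longrightarrow> length p < k"
begin

text \<open>A search state: \<open>A\<close> is finished, \<open>q\<close> is the stack with the
  active vertex last.\<close>

definition dfs :: "'b set \<Rightarrow> 'b list \<Rightarrow> bool" where
  "dfs A q \<longleftrightarrow> A \<subseteq> V \<and> set q \<subseteq> V - A \<and> distinct q \<and> successively h q \<and>
     (\<forall>a\<in>A. \<forall>v\<in>V. h a v \<longrightarrow> v \<in> A \<union> set q)"

definition low :: "'b \<Rightarrow> bool" where
  "low v \<longleftrightarrow> card {w \<in> V. h v w} + 1 < k"

text \<open>The stack is extended by \<open>r\<close> until it is stuck at its end \<open>b\<close>,
  which is then finished and popped. An empty \<open>r\<close> means mere backtracking.\<close>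

lemma dfs_step:
  assumes "dfs A q" "A \<noteq> V"
  obtains r b q' where "q @ r = q' @ [b]" "dfs (insert b A) q'" "b \<notin> A"
    "set r \<subseteq> V - A - set q" "Suc (length q') < k"
proof -
  define ok where "ok r \<longleftrightarrow> distinct (q @ r) \<and> successively h (q @ r) \<and> set (q @ r) \<subseteq> V - A" for r
  have "ok []" using assms(1) by (auto simp: ok_def dfs_def)
  moreover have "\<forall>r. ok r \<longrightarrow> length r < k"
  proof (intro allI impI)
    fix r assume "ok r"
    then have "length (q @ r) < k" by (intro path_short) (auto simp: ok_def)
    then show "length r < k" by simp
  qed
  ultimately have "\<exists>r. ok r \<and> (\<forall>s. ok s \<longrightarrow> length s \<le> length r)"
    by (rule ex_has_greatest_nat)
  then obtain r where r: "ok r" and max: "\<And>s. ok s \<Longrightarrow> length s \<le> length r" by blast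
  have ext: "\<not> ok (r @ [v])" for v using max[of "r @ [v]"] by auto
  have "q @ r \<noteq> []"
  proof
    assume "q @ r = []"
    moreover obtain v where "v \<in> V - A" using assms by (auto simp: dfs_def)
    ultimately have "ok (r @ [v])" by (auto simp: ok_def)
    then show False using ext by blast
  qed
  then obtain q' b where qb: "q @ r = q' @ [b]" by (metis rev_exhaust)
  have stuck: "v \<in> A \<union> set (q @ r)" if "v \<in> V" "h b v" for v
  proof (rule ccontr)
    assume "v \<notin> A \<union> set (q @ r)"
    moreover have "successively h ((q @ r) @ [v])"
      using r that(2) unfolding ok_def qb successively_append_iff by simp
    then have "successively h (q @ r @ [v])" by simp
    ultimately have "ok (r @ [v])"
      using r that(1) by (simp add: ok_def)
    then show False using ext by blast
  qed
  have path: "distinct (q' @ [b])" "successively h (q' @ [b])" "set (q' @ [b]) \<subseteq> V - A"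
    using r unfolding ok_def qb by auto
  have sub: "set q \<subseteq> set (q' @ [b])" using qb by (metis set_append Un_upper1)
  have "dfs (insert b A) q'"
    unfolding dfs_def
  proof (intro conjI ballI impI)
    fix a v assume "a \<in> insert b A" "v \<in> V" "h a v"
    then have "v \<in> A \<union> set (q' @ [b])"
      using assms(1) stuck[of v] sub unfolding dfs_def qb by (cases "a = b") blast+
    then show "v \<in> insert b A \<union> set q'" by auto
  qed (use assms(1) path in \<open>auto simp: dfs_def successively_append_iff\<close>)
  moreover have "length (q' @ [b]) < k" using path by (intro path_short) auto
  moreover have "set r \<subseteq> V - A - set q" using r by (auto simp: ok_def)
  ultimately show thesis using that[of r q' b] qb path by auto
qed

text \<open>The set \<open>I\<close> consists of leaves of a depth-first search forest: the neighbours of a leaf are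
  its ancestors, and every vertex lies on one of the root-to-leaf paths, which have fewer than
  \<open>k\<close> vertices.\<close>

lemma dfs_leaves:
  assumes "dfs A q"
  shows "\<exists>I \<subseteq> V - A - set q. (\<forall>i\<in>I. \<forall>j\<in>I. \<not> h i j) \<and> (\<forall>i\<in>I. low i) \<and>
    card (V - A - set q) \<le> (k - 1) * card I"
  using assms
proof (induction "card (V - A)" arbitrary: A q rule: less_induct)
  case less
  show ?case
  proof (cases "A = V")
    case True
    then show ?thesis by (intro exI[of _ "{}"]) auto
  next
    case False
    then obtain r b q' where s: "q @ r = q' @ [b]" "dfs (insert b A) q'" "b \<notin> A"
      "set r \<subseteq> V - A - set q" "Suc (length q') < k"
      by (rule dfs_step[OF less.prems])
    have bV: "b \<in> V" using s(2) by (auto simp: dfs_def)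
    have set_eq: "set q \<union> set r = insert b (set q')" using arg_cong[OF s(1), of set] by auto
    have "card (V - insert b A) < card (V - A)"
      using bV s(3) finite_V by (intro psubset_card_mono) auto
    then obtain J where J: "J \<subseteq> V - insert b A - set q'" "\<forall>i\<in>J. \<forall>j\<in>J. \<not> h i j" "\<forall>i\<in>J. low i"
      "card (V - insert b A - set q') \<le> (k - 1) * card J"
      using less.hyps[OF _ s(2)] by blast
    have rest: "V - insert b A - set q' = V - A - set q - set r" using set_eq by blast
    show ?thesis
    \<comment> \<open>If \<open>r\<close> is empty, \<open>b\<close> only leaves the stack and the
      unvisited set is unchanged. Otherwise \<open>b\<close> was unvisited and is a new
      leaf.\<close>
    proof (cases "r = []")
      case True
      then show ?thesis using J unfolding rest by (intro exI[of _ J]) auto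
    next
      case nonempty: False
      then have "b \<in> set r" using s(1) by (metis last_appendR last_in_set last_snoc)
      then have b: "b \<notin> A" "b \<notin> set q" using s(4) by auto
      \<comment> \<open>Being unvisited so far, \<open>b\<close> has no neighbour in
        \<open>A\<close>; being stuck, it has none outside \<open>A\<close> and the stack.\<close>
      have nb: "v \<in> set q'" if "v \<in> V" "h b v" for v
      proof -
        have "v \<in> insert b A \<union> set q'" using s(2) that by (auto simp: dfs_def)
        moreover have "v \<notin> A" using less.prems sym[OF that(2)] bV b by (auto simp: dfs_def)
        ultimately show ?thesis using irrefl that(2) by auto
      qed
      have "card {w \<in> V. h b w} \<le> card (set q')" using nb by (intro card_mono) auto
      also have "\<dots> \<le> length q'" by (rule card_length)
      finally have "low b" using s(5) by (simp add: low_def)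
      have indep: "\<not> h b j" "\<not> h j b" if "j \<in> J" for j
        using nb[of j] J(1) that sym by auto
      have bJ: "b \<notin> J" using J(1) by auto
      have finJ: "finite J" using J(1) finite_V by (meson finite_Diff finite_subset)
      have "length (q @ r) \<le> k - 1" using s(1,5) by simp
      then have len: "card (set r) \<le> k - 1" using card_length[of r] by simp
      \<comment> \<open>The at most \<open>k - 1\<close> vertices of \<open>r\<close> are charged to
        the new leaf \<open>b\<close>.\<close>
      have "card (V - A - set q) \<le> card (V - A - set q - set r) + card (set r)"
        using diff_card_le_card_Diff[of "set r" "V - A - set q"] by simp
      also have "\<dots> \<le> (k - 1) * card (insert b J)"
        using J(4) len bJ finJ unfolding rest by simp
      finally show ?thesis
        using J s(4) set_eq \<open>low b\<close> indep irrefl b bV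
        by (intro exI[of _ "insert b J"]) auto
    qed
  qed
qed

lemma dfs_empty: "dfs {} []"
  by (simp add: dfs_def)

text \<open>As long as the search only backtracks from the end of its first maximal path, the set
  \<open>A \<union> set q\<close> does not grow; the first vertex visited off this path is not adjacent to the
  vertices finished before.\<close>

lemma dfs_card:
  assumes "1 \<le> j" "j \<le> card V"
  shows "\<exists>A q. dfs A q \<and> card A = j \<and> Suc (length q) < k \<and>
    ((\<exists>u\<in>A. \<exists>v\<in>A. u \<noteq> v \<and> \<not> h u v) \<or> card A + length q < k)"
  using assms
proof (induction j rule: nat_induct_at_least)
  case base
  then have "{} \<noteq> V" by auto
  then obtain r b q' where "dfs (insert b {}) q'" "Suc (length q') < k"
    by (rule dfs_step[OF dfs_empty])
  then show ?case by (intro exI[of _ "{b}"] exI[of _ q']) auto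
next
  case (Suc j)
  then obtain A q where A: "dfs A q" "card A = j" "Suc (length q) < k"
    "(\<exists>u\<in>A. \<exists>v\<in>A. u \<noteq> v \<and> \<not> h u v) \<or> card A + length q < k"
    by (metis Suc_leD)
  have "A \<noteq> V" using A(2) Suc.prems by auto
  then obtain r b q' where s: "q @ r = q' @ [b]" "dfs (insert b A) q'" "b \<notin> A"
      "set r \<subseteq> V - A - set q" "Suc (length q') < k"
    by (rule dfs_step[OF A(1)])
  have finA: "finite A" using A(1) finite_V by (auto simp: dfs_def intro: finite_subset)
  have "(\<exists>u\<in>insert b A. \<exists>v\<in>insert b A. u \<noteq> v \<and> \<not> h u v) \<or> card (insert b A) + length q' < k"
  proof (cases "r = []")
    case True
    then have "length q = Suc (length q')" using s(1) by simp
    then show ?thesis using A(4) finA s(3) by auto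
  next
    case False
    then have "b \<in> set r" using s(1) by (metis last_appendR last_in_set last_snoc)
    then have b: "b \<notin> A \<union> set q" "b \<in> V" using s(4) by auto
    obtain a where "a \<in> A" using A(2) Suc.hyps by (metis One_nat_def all_not_in_conv card.empty not_one_le_zero)
    moreover have "\<not> h a b" using A(1) \<open>a \<in> A\<close> b by (auto simp: dfs_def)
    ultimately show ?thesis using s(3) by (metis insertCI)
  qed
  then show ?case using s(2,3,5) A(2) finA by (intro exI[of _ "insert b A"] exI[of _ q']) auto
qed

text \<open>The subgraph induced by \<open>A\<close> has no long path either, so its search leaves
  serve.\<close>

lemma independent_subset:
  assumes "A \<subseteq> V"
  shows "\<exists>I \<subseteq> A. (\<forall>i\<in>I. \<forall>j\<in>I. \<not> h i j) \<and> card A \<le> (k - 1) * card I"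
proof -
  interpret sub: path_free A h k
  proof
    show "finite A" using assms finite_V by (rule finite_subset)
  qed (use assms sym irrefl path_short in auto)
  show ?thesis using sub.dfs_leaves[OF sub.dfs_empty] by auto
qed

end

section \<open>Cuts of connected graphs\<close>

definition crossing :: "'a set \<Rightarrow> 'a set \<Rightarrow> 'a set set \<Rightarrow> 'a set set" where
  "crossing X Y E = {e \<in> E. e \<inter> X \<noteq> {} \<and> e \<inter> Y \<noteq> {}}"

text \<open>\<open>covered\<close> is what a spanning tree provides: each vertex has an edge to the
  other side.\<close>

locale cut =
  fixes X Y :: "'a set" and E :: "'a set set"
  assumes finite_X: "finite X" and finite_Y: "finite Y" and disjoint: "X \<inter> Y = {}"
    and edges: "E \<subseteq> nsets (X \<union> Y) 2"
    and covered: "X \<union> Y \<subseteq> \<Union> (crossing X Y E)"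
begin

text \<open>The bad edges, with both ends on one side.\<close>

definition M :: "'a set set" where
  "M = E - crossing X Y E"

text \<open>The vertices of \<open>Y\<close> outside \<open>C\<close> are the leaves of the graph whose neighbour lies in \<open>X\<close>.\<close>

definition C :: "'a set" where
  "C = {y \<in> Y. y \<in> \<Union> M \<or> card {e \<in> crossing X Y E. y \<in> e} \<noteq> 1}"

lemma crossing_swap: "crossing Y X E = crossing X Y E"
  by (auto simp: crossing_def)

lemma swap: "cut Y X E"
  using finite_X finite_Y disjoint edges covered
  by unfold_locales (simp_all add: crossing_swap Un_commute Int_commute)

lemma swap_M: "cut.M Y X E = M"
  by (simp add: cut.M_def[OF swap] M_def crossing_swap)

lemma finite_E: "finite E"
  using edges finite_X finite_Y by (meson finite_UnI finite_imp_finite_nsets finite_subset)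

lemma edgeD: "{u, v} \<in> E \<Longrightarrow> u \<in> X \<union> Y \<and> v \<in> X \<union> Y \<and> u \<noteq> v"
  using edges by (auto simp: nsets_def doubleton_eq_iff card_insert_if split: if_splits)

lemma M_cases:
  assumes "{u, v} \<in> M"
  shows "u \<in> X \<and> v \<in> X \<or> u \<in> Y \<and> v \<in> Y"
  using assms edgeD[of u v] by (auto simp: M_def crossing_def)

lemma edge_cases:
  assumes "{u, v} \<in> E"
  obtains "{u, v} \<in> M" | "u \<in> X" "v \<in> Y" | "u \<in> Y" "v \<in> X"
  using assms edgeD[of u v] by (auto simp: M_def crossing_def)

lemma card_E: "card E = card (crossing X Y E) + card M"
proof -
  have "crossing X Y E \<subseteq> E" by (auto simp: crossing_def)
  then show ?thesis using finite_E
    by (simp add: M_def card_Diff_subset finite_subset card_mono)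
qed

lemma card_Union_M: "card (\<Union> M) \<le> 2 * card M"
proof -
  have "card (\<Union> M) \<le> (\<Sum>e\<in>M. card e)"
    by (rule card_Union_le_sum_card)
  also have "\<dots> = (\<Sum>e\<in>M. 2)"
    using edges by (intro sum.cong) (auto simp: M_def nsets_def)
  finally show ?thesis by simp
qed

text \<open>Crossing edges are counted by their ends in \<open>Y\<close>. Each vertex of
  \<open>Y\<close> has at least one, so the excess over \<open>card Y\<close> bounds the number of
  vertices with several; the rest of \<open>C\<close> lies on bad edges.\<close>

lemma card_C: "card C + card Y \<le> card (Y \<inter> \<Union> M) + card (crossing X Y E)"
proof -
  let ?F = "crossing X Y E"
  let ?d = "\<lambda>y. card {e \<in> ?F. y \<in> e}"
  let ?B = "{y \<in> Y. ?d y \<noteq> 1}"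
  have finF: "finite ?F" using finite_E by (auto simp: crossing_def)
  have F: "?F = (\<Union>y\<in>Y. {e \<in> ?F. y \<in> e})" by (auto simp: crossing_def)
  have unique: "y = y'" if "e \<in> ?F" "y \<in> e" "y' \<in> e" "y \<in> Y" "y' \<in> Y" for e y y'
  proof -
    have "e \<inter> X \<noteq> {}" using that(1) by (simp add: crossing_def)
    then obtain x where "x \<in> e" "x \<in> X" by blast
    moreover have "card e = 2" using that(1) edges by (auto simp: crossing_def nsets_def)
    ultimately show ?thesis using that disjoint by (auto simp: card_2_iff)
  qed
  have "card ?F = (\<Sum>y\<in>Y. ?d y)"
    by (subst F, rule card_UN_disjoint) (use finite_Y finF unique in auto)
  also have "\<dots> \<ge> (\<Sum>y\<in>Y. 1 + of_bool (?d y \<noteq> 1))"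
  proof (intro sum_mono)
    fix y assume "y \<in> Y"
    then have "{e \<in> ?F. y \<in> e} \<noteq> {}" using covered by auto
    then have "?d y \<noteq> 0" using finF by auto
    then show "1 + of_bool (?d y \<noteq> 1) \<le> ?d y" by auto
  qed
  also have "(\<Sum>y\<in>Y. 1 + of_bool (?d y \<noteq> 1)) = card Y + card ?B"
    using finite_Y by (simp only: sum.distrib sum_of_bool_eq) (simp add: Int_def)
  finally have "card Y + card ?B \<le> card ?F" .
  moreover have "card C \<le> card ((Y \<inter> \<Union> M) \<union> ?B)"
    using finite_Y by (intro card_mono) (auto simp: C_def)
  moreover have "card ((Y \<inter> \<Union> M) \<union> ?B) \<le> card (Y \<inter> \<Union> M) + card ?B" by (rule card_Un_le)
  ultimately show ?thesis by linarith
qed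

lemma finite_C: "finite C"
  using finite_Y by (simp add: C_def)

lemma leafE:
  assumes "y \<in> Y - C"
  obtains x where "x \<in> X" "\<And>v. {y, v} \<in> E \<Longrightarrow> v = x"
proof -
  have y: "y \<in> Y" "y \<notin> \<Union> M" "card {e \<in> crossing X Y E. y \<in> e} = 1"
    using assms by (auto simp: C_def)
  then obtain e where e: "{e \<in> crossing X Y E. y \<in> e} = {e}" by (auto simp: card_1_singleton_iff)
  then have e': "e \<in> E" "y \<in> e" "e \<inter> X \<noteq> {}" by (auto simp: crossing_def)
  then obtain x where x: "x \<in> X" "x \<in> e" by auto
  have "card e = 2" using e' edges by (auto simp: nsets_def)
  then have ex: "e = {y, x}" using e' x y(1) disjoint by (auto simp: card_2_iff)
  have "v = x" if "{y, v} \<in> E" for v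
  proof -
    have "{y, v} \<in> crossing X Y E" using y(2) that by (auto simp: M_def)
    then have "{y, v} \<in> {e}" unfolding e[symmetric] by simp
    then show ?thesis using ex edgeD[OF that] by (auto simp: doubleton_eq_iff)
  qed
  then show thesis using that x by blast
qed

end

text \<open>A spanning tree is grown vertex by vertex, each new vertex going to the side opposite to
  its tree neighbour, so that all tree edges cross.\<close>

lemma connected_cut:
  assumes "simple_graph G" "connected_graph G" "2 \<le> card (verts G)"
  shows "\<exists>X. X \<subseteq> verts G \<and> cut X (verts G - X) (edges G) \<and>
    card (verts G) \<le> Suc (card (crossing X (verts G - X) (edges G)))"
proof -
  let ?V = "verts G" and ?E = "edges G"
  have fin: "finite ?V" and E: "?E \<subseteq> nsets ?V 2" using assms by (auto simp: simple_graph_def)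
  have finE: "finite ?E" using fin E by (meson finite_imp_finite_nsets finite_subset)
  \<comment> \<open>\<open>S\<close> and \<open>T\<close> are the vertices and edges of the tree so
    far, \<open>X\<close> is one colour class. A single vertex has no edge to cover it, hence
    \<open>2 \<le> i\<close>.\<close>
  have "\<exists>S X T. X \<subseteq> S \<and> S \<subseteq> ?V \<and> card S = i \<and> T \<subseteq> crossing X (S - X) ?E \<and>
    (\<forall>e\<in>T. e \<subseteq> S) \<and> Suc (card T) = i \<and> (2 \<le> i \<longrightarrow> S \<subseteq> \<Union> T)" if "1 \<le> i" "i \<le> card ?V" for i
    using that
  proof (induction i rule: nat_induct_at_least)
    case base
    obtain r where "r \<in> ?V" using assms(2) by (auto simp: connected_graph_def)
    then show ?case by (intro exI[of _ "{r}"] exI[of _ "{}"]) auto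
  next
    case (Suc i)
    then obtain S X T where S: "X \<subseteq> S" "S \<subseteq> ?V" "card S = i" "T \<subseteq> crossing X (S - X) ?E"
      "\<forall>e\<in>T. e \<subseteq> S" "Suc (card T) = i" "2 \<le> i \<longrightarrow> S \<subseteq> \<Union> T" by auto
    have "S \<noteq> {}" using S(3) Suc.hyps by auto
    then obtain r where r: "r \<in> S" by auto
    have "S \<noteq> ?V" using S(3) Suc.prems by auto
    then obtain z where z: "z \<in> ?V" "z \<notin> S" using S(2) by auto
    have "(r, z) \<in> (adj G)\<^sup>*" using assms(2) r z S(2) by (auto simp: connected_graph_def)
    then have "\<exists>s v. (s, v) \<in> adj G \<and> s \<in> S \<and> v \<notin> S"
      using r z(2) by (induction rule: rtrancl_induct) blast+
    then obtain s v where sv: "{s, v} \<in> ?E" "s \<in> S" "v \<notin> S" by (auto simp: adj_def)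
    have vV: "v \<in> ?V" using E sv(1) by (auto simp: nsets_def)
    define X' where "X' = (if s \<in> X then X else insert v X)"
    have finS: "finite S" using S(2) fin by (rule finite_subset)
    have finT: "finite T" using S(4) finE by (auto simp: crossing_def intro: finite_subset)
    have new: "{s, v} \<notin> T" using S(5) sv(3) by auto
    have cov: "S \<subseteq> insert s (\<Union> T)"
    proof (cases "2 \<le> i")
      case True then show ?thesis using S(7) by auto
    next
      case False
      then have "card S = 1" using S(3) Suc.hyps by simp
      then show ?thesis using sv(2) by (auto simp: card_1_singleton_iff)
    qed
    have T': "insert {s, v} T \<subseteq> crossing X' (insert v S - X') ?E"
      using S(1,4) sv by (auto simp: crossing_def X'_def)
    show ?case
    proof (intro exI conjI)
      show "X' \<subseteq> insert v S" using S(1) by (auto simp: X'_def)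
      show "insert {s, v} T \<subseteq> crossing X' (insert v S - X') ?E" by (rule T')
      show "insert v S \<subseteq> ?V" using S(2) vV by auto
      show "card (insert v S) = Suc i" using finS sv(3) S(3) by simp
      show "\<forall>e\<in>insert {s, v} T. e \<subseteq> insert v S" using S(5) sv(2) by auto
      show "Suc (card (insert {s, v} T)) = Suc i" using finT new S(6) by simp
      show "2 \<le> Suc i \<longrightarrow> insert v S \<subseteq> \<Union> (insert {s, v} T)" using cov by auto
    qed
  qed
  from this[of "card ?V"] obtain S X T where S: "X \<subseteq> S" "S \<subseteq> ?V" "card S = card ?V"
    "T \<subseteq> crossing X (S - X) ?E" "Suc (card T) = card ?V" "S \<subseteq> \<Union> T"
    using assms(3) by auto
  have [simp]: "S = ?V" using S(2,3) fin by (simp add: card_subset_eq)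
  have "card T \<le> card (crossing X (?V - X) ?E)"
    using S(4) finE by (intro card_mono) (auto simp: crossing_def)
  moreover have "cut X (?V - X) ?E"
  proof
    show "finite X" using S(1) fin by (auto intro: finite_subset)
    show "?E \<subseteq> nsets (X \<union> (?V - X)) 2" using E S(1) by (simp add: Un_absorb1)
    have "\<Union> T \<subseteq> \<Union> (crossing X (?V - X) ?E)" using S(4) by (intro Union_mono) simp
    then show "X \<union> (?V - X) \<subseteq> \<Union> (crossing X (?V - X) ?E)" using S(1,6) by (simp add: Un_absorb1)
  qed (use fin in auto)
  ultimately show ?thesis using S(1,5) by auto
qed


section \<open>Packing a sparse graph and a graph without long paths\<close>

text \<open>An embedding of the graph \<open>(W, E)\<close> into the complement of
  \<open>H\<close>.\<close>

definition packing :: "'a set \<Rightarrow> 'a set set \<Rightarrow> 'b set \<Rightarrow> ('b \<Rightarrow> 'b \<Rightarrow> bool) \<Rightarrow> ('a \<Rightarrow> 'b) \<Rightarrow> bool" where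
  "packing W E V h f \<longleftrightarrow> inj_on f W \<and> f ` W \<subseteq> V \<and>
     (\<forall>u\<in>W. \<forall>v\<in>W. {u, v} \<in> E \<longrightarrow> \<not> h (f u) (f v))"

text \<open>For mapping one side of a cut with its ends of bad edges (\<open>Z\<close>) going to an
  independent set \<open>I\<close>.\<close>

lemma inj_on_into:
  assumes "finite X" "finite A" "Z \<subseteq> X" "I \<subseteq> A" "card Z \<le> card I" "card X \<le> card A"
  shows "\<exists>f. inj_on f X \<and> f ` X \<subseteq> A \<and> f ` Z \<subseteq> I"
proof -
  have fin: "finite Z" "finite I" using assms by (auto intro: finite_subset)
  then obtain g where g: "inj_on g Z" "g ` Z \<subseteq> I"
    using assms(5) by (metis inj_on_iff_card_le)
  have "card (X - Z) \<le> card (A - g ` Z)"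
    using assms g fin by (simp add: card_Diff_subset card_image subset_trans)
  then obtain g' where g': "inj_on g' (X - Z)" "g' ` (X - Z) \<subseteq> A - g ` Z"
    using assms by (metis inj_on_iff_card_le finite_Diff)
  let ?f = "\<lambda>x. if x \<in> Z then g x else g' x"
  have "inj_on ?f (Z \<union> (X - Z))"
    using g g' by (intro inj_on_disjoint_Un) auto
  moreover have "Z \<union> (X - Z) = X" using assms(3) by auto
  ultimately show ?thesis
    using g g' assms by (intro exI[of _ ?f]) auto
qed

text \<open>\<open>card_V\<close> states that \<open>H\<close> has \<open>n + k - 2\<close>
  vertices, without truncated subtraction.\<close>

locale cut_path_free = cut X Y E + path_free V h k
  for X Y :: "'a set" and E :: "'a set set" and V :: "'b set" and h :: "'b \<Rightarrow> 'b \<Rightarrow> bool"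
    and k :: nat +
  assumes card_V: "card V + 2 = card X + card Y + k"
begin

lemma swapped: "cut_path_free Y X E V h k"
  using card_V by (intro cut_path_free.intro swap path_free_axioms) (unfold_locales, simp)

text \<open>\<open>X\<close> goes to \<open>A\<close> and \<open>Y\<close> to unvisited vertices,
  which have no neighbour in \<open>A\<close>; only bad edges matter, and their ends go to
  independent sets. The bound on \<open>Y\<close> says that its bad ends number at most
  \<open>card Y / (k - 1)\<close> rounded up, the size that \<open>independent_subset\<close>
  guarantees.\<close>

lemma packing_across:
  assumes A: "dfs A q" "card A = card X" "Suc (length q) < k"
    and I: "I \<subseteq> A" "\<forall>i\<in>I. \<forall>j\<in>I. i \<noteq> j \<longrightarrow> \<not> h i j" "card (X \<inter> \<Union> M) \<le> card I"
    and Y: "(k - 1) * card (Y \<inter> \<Union> M) < card Y + (k - 1)"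
  shows "\<exists>f. packing (X \<union> Y) E V h f"
proof -
  define B where "B = V - A - set q"
  have sub: "A \<subseteq> V" "set q \<subseteq> V - A" using A(1) by (auto simp: dfs_def)
  then have fin: "finite A" "finite B" using finite_V by (auto simp: B_def intro: finite_subset)
  have "card V - card A \<le> card (V - A)" by (rule diff_card_le_card_Diff[OF fin(1)])
  moreover have "card (V - A) - card (set q) \<le> card B"
    unfolding B_def by (rule diff_card_le_card_Diff) simp
  moreover have "card (set q) \<le> length q" by (rule card_length)
  \<comment> \<open>The stack takes at most \<open>k - 2\<close> vertices, exactly the surplus in
    \<open>card_V\<close>.\<close>
  ultimately have card_B: "card Y \<le> card B" using A(2,3) card_V by linarith
  obtain J where J: "J \<subseteq> B" "\<forall>i\<in>J. \<forall>j\<in>J. \<not> h i j" "card B \<le> (k - 1) * card J"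
    using independent_subset[of B] by (auto simp: B_def)
  have "(k - 1) * card (Y \<inter> \<Union> M) < (k - 1) * Suc (card J)"
    using Y card_B J(3) by simp
  then have "card (Y \<inter> \<Union> M) \<le> card J"
    by (simp only: mult_less_cancel1 less_Suc_eq_le)
  then obtain g where g: "inj_on g Y" "g ` Y \<subseteq> B" "g ` (Y \<inter> \<Union> M) \<subseteq> J"
    using inj_on_into[of Y B "Y \<inter> \<Union> M" J] finite_Y fin J(1) card_B by auto
  obtain f where f: "inj_on f X" "f ` X \<subseteq> A" "f ` (X \<inter> \<Union> M) \<subseteq> I"
    using inj_on_into[of X A "X \<inter> \<Union> M" I] finite_X fin I A(2) by auto
  let ?f = "\<lambda>v. if v \<in> X then f v else g v"
  have fY: "?f v = g v" if "v \<in> Y" for v using that disjoint by auto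
  have AB: "\<not> h a b" "\<not> h b a" if "a \<in> A" "b \<in> B" for a b
    using A(1) that sym unfolding dfs_def B_def by blast+
  have "inj_on ?f (X \<union> Y)"
  proof (rule inj_on_disjoint_Un[OF f(1) g(1)])
    show "f ` X \<inter> g ` Y = {}" using f(2) g(2) by (fastforce simp: B_def)
  qed
  moreover have "?f ` (X \<union> Y) \<subseteq> V" using f(2) g(2) sub(1) by (auto simp: B_def)
  moreover have "\<not> h (?f u) (?f v)" if "{u, v} \<in> E" for u v
    using that
  proof (cases rule: edge_cases)
    case 1
    have "u \<noteq> v" using edgeD[OF that] by simp
    have UM: "u \<in> \<Union> M" "v \<in> \<Union> M" using 1 by auto
    from M_cases[OF 1] show ?thesis
    proof
      assume X: "u \<in> X \<and> v \<in> X"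
      then have "u \<in> X \<inter> \<Union> M" "v \<in> X \<inter> \<Union> M" using UM by simp_all
      then have "f u \<in> I" "f v \<in> I" using f(3) by blast+
      moreover have "f u \<noteq> f v" using f(1) X \<open>u \<noteq> v\<close> by (simp add: inj_on_eq_iff)
      ultimately show ?thesis using I(2) X by simp
    next
      assume Y: "u \<in> Y \<and> v \<in> Y"
      then have "u \<in> Y \<inter> \<Union> M" "v \<in> Y \<inter> \<Union> M" using UM by simp_all
      then have "g u \<in> J" "g v \<in> J" using g(3) by blast+
      then show ?thesis using J(2) Y fY by simp
    qed
  next
    case 2
    then have "f u \<in> A" "g v \<in> B" using f(2) g(2) by auto
    then show ?thesis using 2 fY[OF \<open>v \<in> Y\<close>] AB by simp
  next
    case 3
    then have "f v \<in> A" "g u \<in> B" using f(2) g(2) by auto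
    then show ?thesis using 3 fY[OF \<open>u \<in> Y\<close>] AB by simp
  qed
  ultimately show ?thesis unfolding packing_def by blast
qed

text \<open>Any finished set of \<open>card X\<close> vertices contains an independent set large
  enough for the bad ends in \<open>X\<close>.\<close>

lemma packing_large_sides:
  assumes "2 \<le> k" "X \<noteq> {}"
    and X: "(k - 1) * card (X \<inter> \<Union> M) < card X + (k - 1)"
    and Y: "(k - 1) * card (Y \<inter> \<Union> M) < card Y + (k - 1)"
  shows "\<exists>f. packing (X \<union> Y) E V h f"
proof -
  have "1 \<le> card X" using finite_X assms(2) by (simp add: Suc_le_eq card_gt_0_iff)
  moreover have "card X \<le> card V" using card_V assms(1) Y by linarith
  ultimately obtain A q where A: "dfs A q" "card A = card X" "Suc (length q) < k"
    using dfs_card by blast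
  then obtain I where I: "I \<subseteq> A" "\<forall>i\<in>I. \<forall>j\<in>I. \<not> h i j" "card A \<le> (k - 1) * card I"
    using independent_subset[of A] by (auto simp: dfs_def)
  have "(k - 1) * card (X \<inter> \<Union> M) < (k - 1) * Suc (card I)"
    using X A(2) I(3) by simp
  then have "card (X \<inter> \<Union> M) \<le> card I"
    by (simp only: mult_less_cancel1 less_Suc_eq_le)
  then show ?thesis using packing_across[OF A] I Y by blast
qed

text \<open>A low vertex has at least \<open>card (X \<union> Y) - 1\<close> non-neighbours, so the leaves can be added
  greedily.\<close>

lemma packing_leaves:
  assumes f: "packing (X \<union> C) E V h f" and low: "\<forall>x\<in>X. low (f x)"
  shows "\<exists>f. packing (X \<union> Y) E V h f"
proof -
  have CY: "C \<subseteq> Y" by (auto simp: C_def)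
  have "\<exists>g. packing (X \<union> C \<union> W) E V h g \<and> (\<forall>x\<in>X. g x = f x)" if "finite W" "W \<subseteq> Y - C" for W
    using that
  proof (induction W)
    case empty
    then show ?case using f by auto
  next
    case (insert w W)
    then obtain g where g: "packing (X \<union> C \<union> W) E V h g" "\<forall>x\<in>X. g x = f x" by auto
    let ?S = "X \<union> C \<union> W"
    obtain x where x: "x \<in> X" "\<And>v. {w, v} \<in> E \<Longrightarrow> v = x"
      using insert.prems leafE by (metis insert_subset)
    have w: "w \<notin> ?S" "w \<in> Y" using insert disjoint by auto
    have S: "?S \<subseteq> X \<union> (Y - {w})" using w CY insert.prems by auto
    have finS: "finite ?S" using finite_X finite_Y S by (meson finite_Diff finite_UnI finite_subset)
    have "card ?S \<le> card (X \<union> (Y - {w}))" using S finite_X finite_Y by (intro card_mono) auto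
    also have "\<dots> \<le> card X + (card Y - 1)"
      using card_Un_le[of X "Y - {w}"] w(2) finite_Y by simp
    finally have "card ?S < card X + card Y"
      using w(2) finite_Y card_gt_0_iff[of Y] by auto
    moreover have "card (g ` ?S) \<le> card ?S" using finS by (rule card_image_le)
    moreover have "card {z \<in> V. h (f x) z} + 1 < k" using low x(1) by (simp add: low_def)
    \<comment> \<open>At most \<open>n - 1\<close> images are taken and at most \<open>k - 2\<close>
      vertices are adjacent to \<open>f x\<close>, out of \<open>n + k - 2\<close>.\<close>
    ultimately have "card (g ` ?S) + card {z \<in> V. h (f x) z} < card V"
      using card_V by linarith
    then have "card (g ` ?S \<union> {z \<in> V. h (f x) z}) < card V"
      using card_Un_le le_less_trans by blast
    then obtain z where z: "z \<in> V" "z \<notin> g ` ?S" "\<not> h (f x) z"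
      using card_mono[of "g ` ?S \<union> {z \<in> V. h (f x) z}" V] finS finite_V by fastforce
    let ?g = "g(w := z)"
    have gS: "?g v = g v" if "v \<in> ?S" for v using that w by auto
    have ww: "{w, w} \<notin> E" using edgeD by blast
    have "packing (insert w ?S) E V h ?g"
      unfolding packing_def
    proof (intro conjI ballI impI)
      show "inj_on ?g (insert w ?S)"
        using g(1) z(2) w(1) by (auto simp: packing_def inj_on_def)
      show "?g ` insert w ?S \<subseteq> V" using g(1) z(1) w(1) by (auto simp: packing_def)
      fix u v assume uv: "u \<in> insert w ?S" "v \<in> insert w ?S" "{u, v} \<in> E"
      consider "u = w" "v \<in> ?S" | "v = w" "u \<in> ?S" | "u \<in> ?S" "v \<in> ?S"
        using uv ww by auto
      then show "\<not> h (?g u) (?g v)"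
      proof cases
        case 1
        then have "v = x" using x(2) uv(3) by auto
        then show ?thesis using 1 z(3) g(2) x(1) gS sym by (metis fun_upd_same)
      next
        case 2
        then have "u = x" using x(2) uv(3) by (auto simp: insert_commute)
        then show ?thesis using 2 z(3) g(2) x(1) gS by (metis fun_upd_same)
      next
        case 3
        then show ?thesis using g(1) uv(3) gS by (simp add: packing_def)
      qed
    qed
    moreover have "\<forall>x\<in>X. ?g x = f x" using g(2) w(1) by auto
    ultimately show ?case by (intro exI[of _ ?g]) (simp del: fun_upd_apply)
  qed
  from this[of "Y - C"] obtain g where "packing (X \<union> C \<union> (Y - C)) E V h g"
    using finite_Y by auto
  moreover have "X \<union> C \<union> (Y - C) = X \<union> Y" using CY by auto
  ultimately show ?thesis by auto
qed

text \<open>The whole core \<open>X \<union> C\<close> fits into the independent set of search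
  leaves, which are low as \<open>packing_leaves\<close> requires.\<close>

lemma packing_small_core:
  assumes "2 \<le> k" "(k - 1) * (card X + card C) \<le> card V"
  shows "\<exists>f. packing (X \<union> Y) E V h f"
proof -
  obtain I where I: "I \<subseteq> V" "\<forall>i\<in>I. \<forall>j\<in>I. \<not> h i j" "\<forall>i\<in>I. low i" "card V \<le> (k - 1) * card I"
    using dfs_leaves[OF dfs_empty] by auto
  have fin: "finite (X \<union> C)" "finite I"
    using finite_X finite_C I(1) finite_V by (auto intro: finite_subset)
  have "(k - 1) * (card X + card C) \<le> (k - 1) * card I" using assms(2) I(4) by (rule order_trans)
  then have "card X + card C \<le> card I" using assms(1) by simp
  then have "card (X \<union> C) \<le> card I" using card_Un_le[of X C] by simp
  then obtain f where f: "inj_on f (X \<union> C)" "f ` (X \<union> C) \<subseteq> I"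
    using fin by (metis inj_on_iff_card_le)
  then have "f v \<in> I" if "v \<in> X \<union> C" for v using that by blast
  then show ?thesis
    using I f by (intro packing_leaves[of f]) (simp_all add: packing_def subset_trans)
qed

lemma packing_one_bad_edge:
  assumes k: "3 \<le> k" "3 * k \<le> card X + card Y"
    and M: "M = {{u, v}}" "u \<in> X" "v \<in> X" and C: "card C < card X"
  shows "\<exists>f. packing (X \<union> Y) E V h f"
proof -
  have "u \<noteq> v" using M(1) edgeD[of u v] by (auto simp: M_def)
  have UM: "X \<inter> \<Union> M = {u, v}" "Y \<inter> \<Union> M = {}" using M disjoint by auto
  have "card {u, v} \<le> card X" using M finite_X by (intro card_mono) auto
  then have X2: "2 \<le> card X" using \<open>u \<noteq> v\<close> by simp
  show ?thesis
  \<comment> \<open>Two bad ends need \<open>2 * (k - 1) < card X + (k - 1)\<close>, that is,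
    \<open>k \<le> card X\<close>.\<close>
  proof (cases "k \<le> card X")
    case True
    then show ?thesis
      using k X2 UM \<open>u \<noteq> v\<close> by (intro packing_large_sides) auto
  next
    case False
    have "card X \<le> card V" using card_V k by linarith
    then obtain A q where A: "dfs A q" "card A = card X" "Suc (length q) < k"
      "(\<exists>a\<in>A. \<exists>b\<in>A. a \<noteq> b \<and> \<not> h a b) \<or> card A + length q < k"
      using dfs_card[of "card X"] X2 by auto
    have A': "A \<subseteq> V" "set q \<subseteq> V - A" "\<And>a z. \<lbrakk>a \<in> A; z \<in> V; h a z\<rbrakk> \<Longrightarrow> z \<in> A \<union> set q"
      using A(1) by (auto simp: dfs_def)
    have finA: "finite A" using A'(1) finite_V by (rule finite_subset)
    show ?thesis
    proof (cases "\<exists>a\<in>A. \<exists>b\<in>A. a \<noteq> b \<and> \<not> h a b")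
      case True
      then obtain a b where "a \<in> A" "b \<in> A" "a \<noteq> b" "\<not> h a b" by blast
      then show ?thesis
        using UM k sym \<open>u \<noteq> v\<close> by (intro packing_across[OF A(1-3), of "{a, b}"]) auto
    next
      case False
      \<comment> \<open>\<open>A\<close> is a clique, so \<open>A\<close> and the stack have fewer
        than \<open>k\<close> vertices together. All neighbours of \<open>A\<close> lie there, so
        \<open>A\<close> is low.\<close>
      then have len: "card A + length q < k" using A(4) by blast
      have card_Aq: "card (A \<union> set q) < k"
        using card_Un_le[of A "set q"] card_length[of q] len by linarith
      obtain I where I: "I \<subseteq> V - A - set q" "\<forall>i\<in>I. low i"
        "card (V - A - set q) \<le> (k - 1) * card I"
        using dfs_leaves[OF A(1)] by auto
      have "card V - card (A \<union> set q) \<le> card (V - (A \<union> set q))"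
        using finA by (intro diff_card_le_card_Diff) simp
      then have "card (V - A - set q) \<noteq> 0" using card_Aq card_V k by (simp add: Diff_Diff_Int set_diff_eq)
      then obtain b where b: "b \<in> I" using I(3) by fastforce
      then have bV: "b \<in> V" "b \<notin> A" "b \<notin> set q" "low b" using I(1,2) by auto
      have lowA: "low a" if "a \<in> A" for a
      proof -
        have "{z \<in> V. h a z} \<subseteq> (A \<union> set q) - {a}" using A'(3) that irrefl by auto
        then have "card {z \<in> V. h a z} \<le> card ((A \<union> set q) - {a})"
          using finA by (intro card_mono) auto
        moreover have "Suc (card ((A \<union> set q) - {a})) = card (A \<union> set q)"
          using that finA by (intro card_Suc_Diff1) auto
        ultimately show ?thesis using card_Aq by (simp add: low_def)
      qed
      have Ab: "\<not> h a b" "\<not> h b a" if "a \<in> A" for a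
        using A'(3)[OF that, of b] bV sym by auto
      \<comment> \<open>No vertex outside \<open>R\<close> is adjacent to \<open>A\<close> or
        \<open>b\<close>. As \<open>R\<close> has at most \<open>2 * k - 2\<close> vertices, at
        least \<open>n - k\<close> remain for \<open>C\<close>, and
        \<open>card C < card X < k\<close>.\<close>
      define R where "R = A \<union> set q \<union> insert b {z \<in> V. h b z}"
      have "card (insert b {z \<in> V. h b z}) < k"
        using bV(4) card_insert_le_m1 finite_V by (simp add: low_def card_insert_if)
      then have "card R + 2 \<le> 2 * k"
        using card_Aq card_Un_le[of "A \<union> set q" "insert b {z \<in> V. h b z}"] unfolding R_def by linarith
      moreover have "card V - card R \<le> card (V - R)"
        using finA finite_V by (intro diff_card_le_card_Diff) (simp add: R_def)
      ultimately have "card C \<le> card (V - R)"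
        using C \<open>\<not> k \<le> card X\<close> card_V k by linarith
      then obtain g where g: "inj_on g C" "g ` C \<subseteq> V - R"
        using finite_C finite_V by (metis finite_Diff inj_on_iff_card_le)
      \<comment> \<open>\<open>u\<close> goes to \<open>b\<close>, which has no neighbour in
        \<open>A\<close>; \<open>v\<close> and the rest of \<open>X\<close> go to
        \<open>A\<close>.\<close>
      obtain f where f: "inj_on f X" "f ` X \<subseteq> insert b A" "f ` {u} \<subseteq> {b}"
        using inj_on_into[of X "insert b A" "{u}" "{b}"] finite_X finA M A(2) bV(2) by auto
      let ?f = "\<lambda>z. if z \<in> X then f z else g z"
      have CY: "C \<subseteq> Y" by (auto simp: C_def)
      then have fC: "?f z = g z" if "z \<in> C" for z using that disjoint by auto
      have away: "\<not> h s t" "\<not> h t s" if "s \<in> insert b A" "t \<in> V - R" for s t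
        using that A'(3) sym unfolding R_def by blast+
      have fuv: "f u = b" "f v \<in> A"
        using f M \<open>u \<noteq> v\<close> by (auto simp: inj_on_def)
      have "packing (X \<union> C) E V h ?f"
        unfolding packing_def
      proof (intro conjI ballI impI)
        show "inj_on ?f (X \<union> C)"
          using f(1,2) g by (intro inj_on_disjoint_Un) (auto simp: R_def)
        show "?f ` (X \<union> C) \<subseteq> V" using f(2) g(2) A'(1) bV(1) by auto
        fix s t assume st: "s \<in> X \<union> C" "t \<in> X \<union> C" "{s, t} \<in> E"
        from st(3) show "\<not> h (?f s) (?f t)"
        proof (cases rule: edge_cases)
          case 1
          then have "{s, t} = {u, v}" using M(1) by simp
          then show ?thesis using fuv Ab M(2,3) by (auto simp: doubleton_eq_iff)
        next
          case 2
          then have "t \<in> C" using st(2) disjoint by auto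
          then have "f s \<in> insert b A" "g t \<in> V - R" using 2 f(2) g(2) by auto
          then show ?thesis using 2 fC[OF \<open>t \<in> C\<close>] away by simp
        next
          case 3
          then have "s \<in> C" using st(1) disjoint by auto
          then have "f t \<in> insert b A" "g s \<in> V - R" using 3 f(2) g(2) by auto
          then show ?thesis using 3 fC[OF \<open>s \<in> C\<close>] away by simp
        qed
      qed
      moreover have "\<forall>x\<in>X. low (?f x)" using f(2) lowA bV(4) by auto
      ultimately show ?thesis by (rule packing_leaves)
    qed
  qed
qed

text \<open>\<open>d\<close> is the excess of edges over vertices. By \<open>card_C\<close>,
  \<open>card C \<le> card X + 2 * d + 1\<close>, so the core has at most \<open>6 * d * k\<close>
  vertices, and \<open>k\<close> times this is below \<open>27 * k^2 * d\<close>.\<close>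

lemma packing_short_side:
  assumes "2 \<le> k" and d: "0 < d" "card E = card X + card Y + d" "card M \<le> Suc d"
    and n: "27 * k\<^sup>2 * d \<le> card X + card Y" and X: "card X \<le> (2 * d + 1) * (k - 1)"
  shows "\<exists>f. packing (X \<union> Y) E V h f"
proof (rule packing_small_core)
  have "card (Y \<inter> \<Union> M) \<le> card (\<Union> M)"
    using finite_E edges by (intro card_mono) (auto simp: M_def nsets_def)
  then have "card (Y \<inter> \<Union> M) \<le> 2 * card M" using card_Union_M by linarith
  then have "card C \<le> card X + 2 * d + 1" using card_C card_E d by linarith
  then have core: "card X + card C \<le> (2 * d + 1) * (2 * (k - 1) + 1)"
  proof -
    have "(2 * d + 1) * (2 * j + 1) = 2 * ((2 * d + 1) * j) + (2 * d + 1)" for j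
      by (simp add: algebra_simps)
    from this[of "k - 1"] show ?thesis using X \<open>card C \<le> card X + 2 * d + 1\<close> by linarith
  qed
  have "(k - 1) * (card X + card C) \<le> k * ((3 * d) * (2 * k))"
    using core d(1) assms(1) by (intro mult_mono order_trans[OF core]) auto
  also have "\<dots> \<le> 27 * k\<^sup>2 * d" by (simp add: power2_eq_square)
  also have "\<dots> \<le> card V" using n card_V assms(1) by linarith
  finally show "(k - 1) * (card X + card C) \<le> card V" .
qed (fact assms(1))

text \<open>By \<open>F\<close>, all but at most one more than the excess of the edges cross.
  Without excess there is at most one bad edge; with excess \<open>d\<close>, the sides are compared
  with \<open>(2 * d + 1) * (k - 1)\<close>.\<close>

theorem packing_exists:
  assumes k: "3 \<le> k" "3 * k \<le> card X + card Y"
    and F: "card X + card Y \<le> Suc (card (crossing X Y E))"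
    and sparse: "27 * k\<^sup>2 * (card E - (card X + card Y)) \<le> card X + card Y"
  shows "\<exists>f. packing (X \<union> Y) E V h f"
proof -
  interpret sw: cut_path_free Y X E V h k by (rule swapped)
  have sw: "packing (Y \<union> X) E V h = packing (X \<union> Y) E V h" by (simp add: Un_commute)
  have "crossing X Y E \<noteq> {}" using F k by auto
  then have nonempty: "X \<noteq> {}" by (auto simp: crossing_def)
  have finM: "finite M" using finite_E by (simp add: M_def)
  have finUM: "finite (\<Union> M)"
    using finM edges by (auto simp: M_def nsets_def)
  show ?thesis
  proof (cases "card E \<le> card X + card Y")
    case True
    then have M1: "card M \<le> 1" using card_E F by linarith
    show ?thesis
    proof (cases "M = {}")
      case True
      then show ?thesis using k nonempty by (intro packing_large_sides) auto
    next
      case False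
      then have "card M = 1" using M1 finM by (simp add: le_Suc_eq)
      then obtain e where e: "M = {e}" by (auto simp: card_1_singleton_iff)
      then have "e \<in> nsets (X \<union> Y) 2" using edges by (auto simp: M_def)
      then obtain u v where uv: "M = {{u, v}}" using e by (auto simp: nsets_def card_2_iff)
      \<comment> \<open>The bad edge does not cross. With \<open>card_C\<close> this makes
        \<open>C\<close> smaller than the side containing that edge.\<close>
      have F1: "card (crossing X Y E) < card X + card Y"
        using True card_E \<open>card M = 1\<close> \<open>card E \<le> _\<close> by linarith
      from uv have "{u, v} \<in> M" by simp
      from M_cases[OF this] show ?thesis
      proof
        assume X: "u \<in> X \<and> v \<in> X"
        then have "Y \<inter> \<Union> M = {}" using uv disjoint by auto
        then have "card C < card X" using card_C F1 by simp
        then show ?thesis using packing_one_bad_edge k uv X by blast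
      next
        assume Y: "u \<in> Y \<and> v \<in> Y"
        then have "X \<inter> \<Union> M = {}" using uv disjoint by auto
        then have "card sw.C < card Y"
          using sw.card_C F1 by (simp add: swap_M crossing_swap)
        then show ?thesis
          using sw.packing_one_bad_edge[of u v] k uv Y by (simp add: swap_M sw)
      qed
    qed
  next
    case False
    define d where "d = card E - (card X + card Y)"
    have d: "0 < d" "card E = card X + card Y + d" using False by (auto simp: d_def)
    have n: "27 * k\<^sup>2 * d \<le> card X + card Y" using sparse by (simp only: d_def)
    have M: "card M \<le> Suc d" using card_E F d(2) by linarith
    show ?thesis
    \<comment> \<open>At most \<open>2 * d + 2\<close> vertices lie on bad edges, and
      \<open>(k - 1) * (2 * d + 2)\<close> is this threshold plus \<open>k - 1\<close>, as
      \<open>packing_large_sides\<close> needs.\<close>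
    proof (cases "(2 * d + 1) * (k - 1) < card X \<and> (2 * d + 1) * (k - 1) < card Y")
      case True
      have "card (Z \<inter> \<Union> M) \<le> 2 * d + 2" for Z
        using card_mono[OF finUM, of "Z \<inter> \<Union> M"] card_Union_M M by simp
      then have "(k - 1) * card (Z \<inter> \<Union> M) \<le> (k - 1) * (2 * d + 2)" for Z
        by (rule mult_le_mono2)
      moreover have "j * (2 * d + 2) = (2 * d + 1) * j + j" for j by (simp add: algebra_simps)
      ultimately have "(k - 1) * card (Z \<inter> \<Union> M) \<le> (2 * d + 1) * (k - 1) + (k - 1)" for Z
        by metis
      then have "(k - 1) * card (Z \<inter> \<Union> M) < z + (k - 1)" if "(2 * d + 1) * (k - 1) < z" for Z z
        using that by (meson add_less_mono1 le_less_trans)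
      then show ?thesis using True k nonempty by (intro packing_large_sides) auto
    next
      case False
      then consider "card X \<le> (2 * d + 1) * (k - 1)" | "card Y \<le> (2 * d + 1) * (k - 1)"
        by linarith
      then show ?thesis
      proof cases
        case 1
        then show ?thesis using packing_short_side[OF _ d M n] k by simp
      next
        case 2
        then show ?thesis
          using k d M n
          by (intro sw.packing_short_side[of d, unfolded swap_M sw]) (simp_all add: add.commute)
      qed
    qed
  qed
qed

end

section \<open>From packings to the Ramsey number\<close>

theorem lemma3p3:
  fixes k n :: nat and G :: "'a ugraph"
  assumes "k \<ge> 3" and "n \<ge> 3 * k"
    and "simple_graph G" and "connected_graph G"
    and "card (verts G) = n"
    and "real (card (edges G)) \<le> (1 + 1 / (27 * (real k)\<^sup>2)) * real n"
  shows "ramsey_number G (path_graph k) \<le> n + k - 2"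
proof -
  have fin: "finite (verts G)" using assms(3) by (simp add: simple_graph_def)
  have "2 \<le> card (verts G)" using assms by simp
  then obtain X where X: "X \<subseteq> verts G" "cut X (verts G - X) (edges G)"
    "n \<le> Suc (card (crossing X (verts G - X) (edges G)))"
    using connected_cut[OF assms(3,4)] unfolding assms(5) by auto
  let ?Y = "verts G - X"
  have XY: "X \<union> ?Y = verts G" "card X + card ?Y = n"
    using X(1) fin assms(5) by (auto simp: card_Diff_subset finite_subset card_mono)
  \<comment> \<open>The real bound, multiplied by \<open>27 * k^2\<close>, bounds the integer
    excess; truncated subtraction settles the case without excess.\<close>
  have sparse: "27 * k\<^sup>2 * (card (edges G) - n) \<le> n"
  proof (cases "card (edges G) \<le> n")
    case False
    have "27 * (real k)\<^sup>2 * real (card (edges G)) \<le> 27 * (real k)\<^sup>2 * ((1 + 1 / (27 * (real k)\<^sup>2)) * real n)"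
      by (intro mult_left_mono assms(6)) simp
    also have "\<dots> = 27 * (real k)\<^sup>2 * real n + real n"
      using assms(1) by (simp add: field_simps)
    finally have "real (27 * k\<^sup>2 * (card (edges G) - n)) \<le> real n"
      using False by (simp add: of_nat_diff algebra_simps)
    then show ?thesis by (simp only: of_nat_le_iff)
  qed simp
  have "contains_graph \<Gamma> G \<or> contains_graph (complement_graph \<Gamma>) (path_graph k)"
    if \<Gamma>: "simple_graph \<Gamma>" "card (verts \<Gamma>) = n + k - 2" for \<Gamma> :: "nat ugraph"
  proof (rule disjCI)
    assume no_path: "\<not> contains_graph (complement_graph \<Gamma>) (path_graph k)"
    \<comment> \<open>\<open>H\<close> is the complement of \<open>\<Gamma>\<close>, so a packing
      embeds \<open>G\<close> into \<open>\<Gamma>\<close>.\<close>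
    define h where "h u v \<longleftrightarrow> {u, v} \<in> edges (complement_graph \<Gamma>)" for u v
    interpret cut_path_free X ?Y "edges G" "verts \<Gamma>" h k
    proof (intro cut_path_free.intro X(2) path_free.intro cut_path_free_axioms.intro)
      show "finite (verts \<Gamma>)" using \<Gamma>(1) by (simp add: simple_graph_def)
      show "h u v \<Longrightarrow> h v u" for u v by (simp add: h_def insert_commute)
      show "\<not> h v v" for v by (simp add: h_def complement_graph_def nsets_def)
      show "length p < k" if p: "distinct p" "successively h p" "set p \<subseteq> verts \<Gamma>" for p
      proof (rule ccontr)
        assume "\<not> length p < k"
        then have len: "k \<le> length p" by simp
        \<comment> \<open>The first \<open>k\<close> vertices of a longer path already form
          \<open>P_k\<close>.\<close>
        have "h (p ! i) (p ! Suc i)" if "Suc i < k" for i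
          using p(2) len that by (simp add: successively_conv_nth)
        moreover have "inj_on ((!) p) {..<k}" using p(1) len by (intro inj_on_nth) auto
        moreover have "(!) p ` {..<k} \<subseteq> verts \<Gamma>" using p(3) len by (auto simp: subset_iff)
        ultimately have "contains_graph (complement_graph \<Gamma>) (path_graph k)"
          unfolding contains_graph_def h_def
          by (intro exI[of _ "(!) p"]) (auto simp: path_graph_def complement_graph_def[of \<Gamma>])
        then show False using no_path by contradiction
      qed
      show "card (verts \<Gamma>) + 2 = card X + card ?Y + k" using \<Gamma>(2) XY(2) assms(1) by simp
    qed
    obtain f where f: "packing (verts G) (edges G) (verts \<Gamma>) h f"
      using packing_exists assms(1,2) X(3) XY sparse by auto
    have "f ` e \<in> edges \<Gamma>" if "e \<in> edges G" for e
    proof -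
      have "e \<in> nsets (verts G) 2" using assms(3) that by (auto simp: simple_graph_def)
      then obtain u v where e: "e = {u, v}" "u \<in> verts G" "v \<in> verts G" "u \<noteq> v"
        by (auto simp: nsets_def card_2_iff)
      then have "\<not> h (f u) (f v)" "f u \<noteq> f v" "f u \<in> verts \<Gamma>" "f v \<in> verts \<Gamma>"
        using f that by (auto simp: packing_def inj_on_def)
      then show ?thesis using e(1) by (simp add: h_def complement_graph_def nsets_def)
    qed
    then show "contains_graph \<Gamma> G" using f by (auto simp: contains_graph_def packing_def)
  qed
  moreover have "0 < n + k - 2" using assms(1) by simp
  ultimately show ?thesis unfolding ramsey_number_def by (intro Least_le conjI allI impI) simp_all
qed

end
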